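(* For every finite set $A$ and all positive integers $m$ and $d$ there exist integers $k_0, k_1 \geq m$ with $k_0 > k_1$ such that for every instance $\Phi$ of $m$-CSP over $A$ either - $\mathrm{val}_{k_0,k_1}(\Phi) = 1$ (i.e., $\Phi$ is solvable), or - $\mathrm{val}_{k_0,k_1}(\Phi) > d$.
   Context: An instance $\Phi$ of $m$-CSP over $A$ consists of a set $V$ of variables, the set $A$, and a collection of local constraints; each constraint is a subset $\varphi \subseteq A^W$ for some $W \subseteq V$ with $|W| \leq m$. A solution of $\Phi$ is a map $f : V \to A$ such that for every constraint $\varphi \subseteq A^W$ the restriction of $f$ to $W$ lies in $\varphi$; $\Phi$ is solvable if it has a solution. For $U \subseteq V$, a partial solution to $\Phi$ on $U$ is a map $g \in A^U$ such that for every constraint $\varphi \subseteq A^W$ with $W \subseteq U$, the restriction of $g$ to $W$ lies in $\varphi$. $\binom{V}{k}$ is the set of all $k$-element subsets of $V$, and $\mathrm{proj}_{U'} f$ denotes the restriction of a map $f$ to $U'$. The $(k_0,k_1)$-value $\mathrm{val}_{k_0,k_1}(\Phi)$ is the smallest positive integer $d$ for which there exist two collections $\mathcal I_0, \mathcal I_1$ such that 1. for $i \in \{0,1\}$ and every $U \in \binom{V}{k_i}$, the set $\mathcal I_i(U) \subseteq A^U$ consists of partial solutions to $\Phi$; 2. every $\mathcal I_i(U)$ has no more than $d$ elements; 3. if $U_0 \supseteq U_1$ are subsets of $V$ of sizes $k_0, k_1$, then there is $f \in \mathcal I_0(U_0)$ such that $\mathrm{proj}_{U_1} f \in \mathcal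 I_1(U_1)$; and $\mathrm{val}_{k_0,k_1}(\Phi) = \infty$ if no such collections exist.
   Formalization: "val = 1 implies solvable" is stated only for |V| ≥ k0 (or V infinite): for |V| < k0 empty collections give val = 1 even if Φ is unsolvable. Also k0, k1 are chosen for a fixed universe of variables; taking ℕ, renaming and compactness give all V. *)

theory Defs
  imports Main "HOL-Library.FuncSet" "HOL-Library.Extended_Nat" "HOL-Library.Ramsey"
begin

text \<open>
  A constraint is a pair of a scope \<open>W\<close> and a set of allowed assignments \<open>\<phi> \<subseteq> A\<^sup>W\<close>. The scope has to be
  recorded, since it cannot be recovered from \<open>\<phi> = {}\<close>. The power \<open>A\<^sup>U\<close> is the extensional function
  space \<open>U \<rightarrow>\<^sub>E A\<close>, so that elements of it are determined by their values on \<open>U\<close>.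

  The type of variables is arbitrary. In a statement of the form \<open>\<exists>k. \<forall>\<Phi> :: ('v, 'a) csp. \<dots>\<close> the
  witness \<open>k\<close> formally depends on \<open>'v\<close>; the case \<open>'v = nat\<close> yields one \<open>k\<close> for all finite instances,
  as every finite set of variables can be renamed into the natural numbers.
\<close>

record ('v, 'a) csp =
  vars :: "'v set"
  alphabet :: "'a set"
  constraints :: "('v set \<times> ('v \<Rightarrow> 'a) set) set"

definition csp_instance :: "nat \<Rightarrow> 'a set \<Rightarrow> ('v, 'a) csp \<Rightarrow> bool" where
  "csp_instance m A \<Phi> \<longleftrightarrow>
     alphabet \<Phi> = A \<and>
     (\<forall>(W, \<phi>) \<in> constraints \<Phi>. W \<subseteq> vars \<Phi> \<and> finite W \<and> card W \<le> m \<and> \<phi> \<subseteq> (W \<rightarrow>\<^sub>E A))"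

definition csp_solution :: "('v, 'a) csp \<Rightarrow> ('v \<Rightarrow> 'a) \<Rightarrow> bool" where
  "csp_solution \<Phi> f \<longleftrightarrow>
     f \<in> vars \<Phi> \<rightarrow>\<^sub>E alphabet \<Phi> \<and> (\<forall>(W, \<phi>) \<in> constraints \<Phi>. restrict f W \<in> \<phi>)"

definition csp_solvable :: "('v, 'a) csp \<Rightarrow> bool" where
  "csp_solvable \<Phi> \<longleftrightarrow> (\<exists>f. csp_solution \<Phi> f)"

definition partial_solution :: "('v, 'a) csp \<Rightarrow> 'v set \<Rightarrow> ('v \<Rightarrow> 'a) \<Rightarrow> bool" where
  "partial_solution \<Phi> U g \<longleftrightarrow>
     g \<in> U \<rightarrow>\<^sub>E alphabet \<Phi> \<and> (\<forall>(W, \<phi>) \<in> constraints \<Phi>. W \<subseteq> U \<longrightarrow> restrict g W \<in> \<phi>)"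

text \<open>
  Only the values of \<open>I0\<close> on \<open>k0\<close>-element sets of variables and those of \<open>I1\<close> on \<open>k1\<close>-element sets
  of variables matter.
\<close>

definition value_witness ::
    "nat \<Rightarrow> nat \<Rightarrow> ('v, 'a) csp \<Rightarrow> nat \<Rightarrow> ('v set \<Rightarrow> ('v \<Rightarrow> 'a) set) \<Rightarrow> ('v set \<Rightarrow> ('v \<Rightarrow> 'a) set) \<Rightarrow> bool" where
  "value_witness k0 k1 \<Phi> d I0 I1 \<longleftrightarrow>
     (\<forall>U \<in> nsets (vars \<Phi>) k0. I0 U \<subseteq> Collect (partial_solution \<Phi> U) \<and> finite (I0 U) \<and> card (I0 U) \<le> d) \<and>
     (\<forall>U \<in> nsets (vars \<Phi>) k1. I1 U \<subseteq> Collect (partial_solution \<Phi> U) \<and> finite (I1 U) \<and> card (I1 U) \<le> d) \<and>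
     (\<forall>U0 \<in> nsets (vars \<Phi>) k0. \<forall>U1 \<in> nsets (vars \<Phi>) k1.
        U1 \<subseteq> U0 \<longrightarrow> (\<exists>f \<in> I0 U0. restrict f U1 \<in> I1 U1))"

text \<open>The infimum of the empty set in \<^typ>\<open>enat\<close> is \<open>\<infinity>\<close>.\<close>

definition csp_val :: "nat \<Rightarrow> nat \<Rightarrow> ('v, 'a) csp \<Rightarrow> enat" where
  "csp_val k0 k1 \<Phi> = Inf {enat d | d. d > 0 \<and> (\<exists>I0 I1. value_witness k0 k1 \<Phi> d I0 I1)}"

end

theory Submission imports Defs begin

text \<open>
  Call \<open>Q \<subseteq> A\<^sup>S\<close> robust if the lists \<open>I U\<close> with restriction \<open>Q\<close> to \<open>S\<close> occur above every set of \<open>t\<close>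
  further variables. A union bound over the finitely many subsets of \<open>A\<^sup>S\<close> shows that robust sets
  extend to robust sets over larger \<open>S\<close>, at the price of decreasing \<open>t\<close>. Take \<open>S\<close>, \<open>Q\<close> robust
  for \<open>I0\<close> and \<open>R\<close> robust for \<open>I1\<close> such that \<open>card (Q \<union> R) \<le> 2d\<close> cannot be increased by passing to
  a larger \<open>S'\<close>. Then restriction is a bijection from \<open>Q' \<union> R'\<close> to \<open>Q \<union> R\<close> for all robust
  extensions \<open>Q'\<close>, \<open>R'\<close>. There is some \<open>h \<in> Q \<inter> R\<close>, and its extension in \<open>Q'\<close> equals the one in \<open>R'\<close>;
  since \<open>Q'\<close> and \<open>R'\<close> are chosen independently, it depends only on \<open>S'\<close>. So these
  extensions are compatible, and they glue to a solution.
\<close>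

subsection \<open>Robust restrictions\<close>

text \<open>Only \<open>T\<close> counts against the budget \<open>t\<close>, not \<open>S\<close>.
  The set \<open>U\<close> may depend on \<open>T\<close>, but \<open>Q\<close> may not.\<close>

definition robust ::
    "'v set \<Rightarrow> nat \<Rightarrow> ('v set \<Rightarrow> ('v \<Rightarrow> 'a) set) \<Rightarrow> nat \<Rightarrow> 'v set \<Rightarrow> ('v \<Rightarrow> 'a) set \<Rightarrow> bool" where
  "robust V k I t S Q \<longleftrightarrow>
     (\<forall>T. T \<subseteq> V \<and> finite T \<and> card T \<le> t \<longrightarrow>
        (\<exists>U \<in> nsets V k. S \<union> T \<subseteq> U \<and> (\<lambda>f. restrict f S) ` I U = Q))"

lemma robustD:
  assumes "robust V k I t S Q" "T \<subseteq> V" "finite T" "card T \<le> t"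
  obtains U where "U \<in> nsets V k" "S \<subseteq> U" "T \<subseteq> U" "(\<lambda>f. restrict f S) ` I U = Q"
proof -
  have "\<exists>U \<in> nsets V k. S \<union> T \<subseteq> U \<and> (\<lambda>f. restrict f S) ` I U = Q"
    using assms unfolding robust_def by simp
  then show ?thesis
    by (elim bexE conjE) (simp add: that)
qed

lemma robust_witness:
  assumes "robust V k I t S Q"
  obtains U where "U \<in> nsets V k" "S \<subseteq> U" "(\<lambda>f. restrict f S) ` I U = Q"
  by (rule robustD[OF assms, of "{}"]) (simp_all add: that)

text \<open>Restrictions compose, so the same \<open>U\<close> serves and none of the budget
  \<open>t\<close> is lost.\<close>

lemma robust_restrict:
  assumes "robust V k I t S' Q" "S \<subseteq> S'"
  shows "robust V k I t S ((\<lambda>f. restrict f S) ` Q)"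
  unfolding robust_def
proof (intro allI impI)
  fix T assume "T \<subseteq> V \<and> finite T \<and> card T \<le> t"
  then obtain U where U: "U \<in> nsets V k" "S' \<subseteq> U" "T \<subseteq> U" "(\<lambda>f. restrict f S') ` I U = Q"
    using robustD[OF assms(1)] by blast
  have "(\<lambda>f. restrict f S) ` Q = (\<lambda>f. restrict f S) ` I U"
    using assms(2) by (auto simp: U(4)[symmetric] image_image Int_absorb1)
  then show "\<exists>U\<in>nsets V k. S \<union> T \<subseteq> U \<and> (\<lambda>f. restrict f S) ` I U = (\<lambda>f. restrict f S) ` Q"
    using U(1-3) assms(2) by (intro bexI[of _ U]) auto
qed

lemma card_Pow_PiE_le:
  assumes "finite S" "card S \<le> s" "finite A"
  shows "finite (Pow (S \<rightarrow>\<^sub>E A)) \<and> card (Pow (S \<rightarrow>\<^sub>E A)) \<le> 2 ^ (Suc (card A) ^ s)"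
proof -
  have "card (S \<rightarrow>\<^sub>E A) = card A ^ card S"
    using assms by (simp add: card_PiE)
  \<comment> \<open>The base \<open>Suc (card A)\<close> is at least 1 even for empty
    \<open>A\<close>, so the exponent can be raised to \<open>s\<close>.\<close>
  also have "\<dots> \<le> Suc (card A) ^ card S"
    by (simp add: power_mono)
  also have "\<dots> \<le> Suc (card A) ^ s"
    using assms by (intro power_increasing) auto
  finally have "card (S \<rightarrow>\<^sub>E A) \<le> Suc (card A) ^ s" .
  then show ?thesis
    using assms by (simp add: card_Pow finite_PiE)
qed

text \<open>If no candidate \<open>Q'\<close> were robust, each would have a blocking set
  \<open>T Q'\<close> of size at most \<open>t\<close>. All of these together with \<open>S'\<close>
  fit into the budget \<open>N * t + s\<close> of \<open>Q\<close>, so a single \<open>U\<close>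
  contains them. The restriction of \<open>I U\<close> to \<open>S'\<close> is then a candidate
  realised above its own blocking set.\<close>

lemma robust_extend:
  assumes rob: "robust V k I (N * t + s) S Q"
    and I: "\<And>U. U \<in> nsets V k \<Longrightarrow> I U \<subseteq> U \<rightarrow>\<^sub>E A"
    and S': "S \<subseteq> S'" "S' \<subseteq> V" "finite S'" "card S' \<le> s"
    and N: "finite (Pow (S' \<rightarrow>\<^sub>E A))" "card (Pow (S' \<rightarrow>\<^sub>E A)) \<le> N"
  obtains Q' where "robust V k I t S' Q'" "(\<lambda>f. restrict f S) ` Q' = Q"
proof (rule ccontr)
  assume neg: "\<not> thesis"
  define P where "P = {Q' \<in> Pow (S' \<rightarrow>\<^sub>E A). (\<lambda>f. restrict f S) ` Q' = Q}"
  have "\<forall>Q'\<in>P. \<exists>T. T \<subseteq> V \<and> finite T \<and> card T \<le> t \<and>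
      \<not> (\<exists>U \<in> nsets V k. S' \<union> T \<subseteq> U \<and> (\<lambda>f. restrict f S') ` I U = Q')"
    using neg that unfolding P_def robust_def by blast
  then obtain T where T: "\<And>Q'. Q' \<in> P \<Longrightarrow> T Q' \<subseteq> V \<and> finite (T Q') \<and> card (T Q') \<le> t"
    and bad: "\<And>Q' U. Q' \<in> P \<Longrightarrow> U \<in> nsets V k \<Longrightarrow> S' \<union> T Q' \<subseteq> U \<Longrightarrow> (\<lambda>f. restrict f S') ` I U \<noteq> Q'"
    by metis
  have "P \<subseteq> Pow (S' \<rightarrow>\<^sub>E A)"
    by (auto simp: P_def)
  then have P: "finite P" "card P \<le> N"
    using N card_mono[OF N(1)] by (blast intro: finite_subset order.trans)+
  have "card (\<Union>(T ` P)) \<le> (\<Sum>Q'\<in>P. card (T Q'))"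
    using P(1) by (rule card_UN_le)
  also have "\<dots> \<le> card P * t"
    using T by (intro order.trans[OF sum_bounded_above[of P _ t]]) auto
  also have "\<dots> \<le> N * t"
    using P(2) by simp
  finally have "card (\<Union>(T ` P) \<union> S') \<le> N * t + s"
    using card_Un_le[of "\<Union>(T ` P)" S'] S'(4) by linarith
  moreover have "\<Union>(T ` P) \<union> S' \<subseteq> V" "finite (\<Union>(T ` P) \<union> S')"
    using P(1) T S' by auto
  ultimately obtain U where U: "U \<in> nsets V k" "\<Union>(T ` P) \<union> S' \<subseteq> U" "(\<lambda>f. restrict f S) ` I U = Q"
    using robustD[OF rob] by metis
  let ?Q' = "(\<lambda>f. restrict f S') ` I U"
  have "?Q' \<subseteq> S' \<rightarrow>\<^sub>E A"
    using I[OF U(1)] U(2) by (fastforce simp: PiE_iff)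
  moreover have "(\<lambda>f. restrict f S) ` ?Q' = Q"
    using S'(1) by (auto simp: U(3)[symmetric] image_image Int_absorb1)
  ultimately have "?Q' \<in> P"
    by (simp add: P_def)
  with bad[OF this U(1)] U(2) show False
    by auto
qed

lemma exists_nsets_superset:
  assumes "finite T" "T \<subseteq> V" "card T \<le> k" "infinite V \<or> k \<le> card V"
  obtains U where "U \<in> nsets V k" "T \<subseteq> U"
proof (cases "finite V")
  case True
  then show ?thesis
    using exists_subset_between[of T k V] assms that by (auto simp: nsets_def intro: finite_subset)
next
  case False
  then obtain B where B: "B \<subseteq> V - T" "finite B" "card B = k - card T"
    using infinite_arbitrarily_large[of "V - T"] assms(1) by (metis Diff_infinite_finite)
  then have "card (T \<union> B) = k"
    using assms by (subst card_Un_disjoint) auto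
  then show ?thesis
    using that[of "T \<union> B"] B assms by (auto simp: nsets_def)
qed

text \<open>Start of the extremal argument: over the empty scope every nonempty list restricts to
  the one extensional function.\<close>

lemma robust_empty:
  fixes I :: "'a set \<Rightarrow> ('a \<Rightarrow> 'b) set"
  assumes "infinite V \<or> k \<le> card V" "t \<le> k" "\<And>U. U \<in> nsets V k \<Longrightarrow> I U \<noteq> {}"
  shows "robust V k I t {} {\<lambda>x. undefined}"
  unfolding robust_def
proof (intro allI impI)
  fix T assume "T \<subseteq> V \<and> finite T \<and> card T \<le> t"
  then obtain U where "U \<in> nsets V k" "T \<subseteq> U"
    using exists_nsets_superset[of T V k] assms by auto
  moreover from this have "(\<lambda>f. restrict f {}) ` I U = {\<lambda>x. undefined}"
    using assms(3)[of U] by (auto simp: restrict_def)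
  ultimately show "\<exists>U\<in>nsets V k. {} \<union> T \<subseteq> U \<and> (\<lambda>f. restrict f {}) ` I U = {\<lambda>x. undefined}"
    by (intro bexI[of _ U]) simp_all
qed

lemma finite_robust:
  assumes "robust V k I t S Q" "\<And>U. U \<in> nsets V k \<Longrightarrow> finite (I U) \<and> card (I U) \<le> d"
  shows "finite Q" "card Q \<le> d"
proof -
  obtain U where U: "U \<in> nsets V k" "(\<lambda>f. restrict f S) ` I U = Q"
    using robust_witness[OF assms(1)] by blast
  show "finite Q" "card Q \<le> d"
    using assms(2)[OF U(1)] U(2) card_image_le[of "I U" "\<lambda>f. restrict f S"] by auto
qed

subsection \<open>Small value implies solvability\<close>

text \<open>The budget that pays for \<open>j\<close> successive uses of
  \<open>robust_extend\<close> and still leaves \<open>b\<close>.\<close>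

fun robustness :: "nat \<Rightarrow> nat \<Rightarrow> nat \<Rightarrow> nat \<Rightarrow> nat" where
  "robustness N s b 0 = b"
| "robustness N s b (Suc j) = N * robustness N s b j + s"

lemma partial_solution_restrict:
  assumes "partial_solution \<Phi> U g" "S \<subseteq> U"
  shows "partial_solution \<Phi> S (restrict g S)"
proof -
  have "restrict (restrict g S) W \<in> \<phi>" if "(W, \<phi>) \<in> constraints \<Phi>" "W \<subseteq> S" for W \<phi>
  proof -
    have "restrict (restrict g S) W = restrict g W"
      using that(2) by (simp add: Int_absorb1)
    then show ?thesis
      using that assms unfolding partial_solution_def by fastforce
  qed
  moreover have "restrict g S \<in> S \<rightarrow>\<^sub>E alphabet \<Phi>"
    using assms unfolding partial_solution_def by (auto simp: PiE_iff)
  ultimately show ?thesis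
    unfolding partial_solution_def by auto
qed

text \<open>The solution takes at \<open>v\<close> the value of the unique extension over
  \<open>S \<union> {v}\<close>. For a constraint with scope \<open>W\<close>, the extension over
  \<open>S \<union> W\<close> restricts to all of these by \<open>proj\<close> and
  \<open>unique\<close>, so it agrees with the solution on \<open>W\<close>, and it satisfies the
  constraint by \<open>partial\<close>.\<close>

lemma csp_solvable_if_compatible_extensions:
  assumes inst: "csp_instance m A \<Phi>" and "m > 0" and "S \<subseteq> vars \<Phi>" "finite S"
    and ex: "\<And>S'. S \<subseteq> S' \<Longrightarrow> S' \<subseteq> vars \<Phi> \<Longrightarrow> finite S' \<Longrightarrow> card S' \<le> card S + m \<Longrightarrow> \<exists>h. H S' h"
    and unique: "\<And>S' h h'. S \<subseteq> S' \<Longrightarrow> S' \<subseteq> vars \<Phi> \<Longrightarrow> finite S' \<Longrightarrow> card S' \<le> card S + m \<Longrightarrow>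
        H S' h \<Longrightarrow> H S' h' \<Longrightarrow> h = h'"
    and proj: "\<And>S' S'' h. S \<subseteq> S' \<Longrightarrow> S' \<subseteq> S'' \<Longrightarrow> H S'' h \<Longrightarrow> H S' (restrict h S')"
    and partial: "\<And>S' h. H S' h \<Longrightarrow> partial_solution \<Phi> S' h"
  shows "csp_solvable \<Phi>"
proof -
  have small: "card (S \<union> W) \<le> card S + m" if "card W \<le> m" for W
    using card_Un_le[of S W] that by linarith
  have "\<exists>h. H (S \<union> {v}) h" if "v \<in> vars \<Phi>" for v
    using assms(2-4) that by (intro ex small) auto
  then obtain h1 where h1: "\<And>v. v \<in> vars \<Phi> \<Longrightarrow> H (S \<union> {v}) (h1 v)"
    by metis
  define f where "f = (\<lambda>v\<in>vars \<Phi>. h1 v v)"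
  have "f \<in> vars \<Phi> \<rightarrow>\<^sub>E alphabet \<Phi>"
    using partial[OF h1] by (fastforce simp: f_def partial_solution_def PiE_iff)
  moreover have "restrict f W \<in> \<phi>" if "(W, \<phi>) \<in> constraints \<Phi>" for W \<phi>
  proof -
    have W: "W \<subseteq> vars \<Phi>" "finite W" "card W \<le> m"
      using inst that by (auto simp: csp_instance_def)
    then obtain h where h: "H (S \<union> W) h"
      using ex[of "S \<union> W"] small assms(3,4) by auto
    have "f v = h v" if "v \<in> W" for v
    proof -
      have "H (S \<union> {v}) (restrict h (S \<union> {v}))"
        using that by (intro proj[OF _ _ h]) auto
      moreover have "v \<in> vars \<Phi>"
        using that W by blast
      ultimately have "restrict h (S \<union> {v}) = h1 v"
        using assms(2-4) by (intro unique[of "S \<union> {v}"] h1 small) auto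
      then show ?thesis
        using \<open>v \<in> vars \<Phi>\<close> by (metis UnCI f_def insertI1 restrict_apply')
    qed
    then have "restrict f W = restrict h W"
      by (auto simp: restrict_def)
    then show ?thesis
      using partial[OF h] that by (auto simp: partial_solution_def)
  qed
  ultimately show ?thesis
    unfolding csp_solvable_def csp_solution_def by blast
qed

lemma value_witness_imp_solvable:
  fixes \<Phi> :: "('v, 'a) csp"
  assumes A: "finite A" and "m > 0"
    and inst: "csp_instance m A \<Phi>"
    and wit: "value_witness k0 k1 \<Phi> d I0 I1"
    and large: "infinite (vars \<Phi>) \<or> k0 \<le> card (vars \<Phi>)"
    and s: "s = (2 * d + 1) * m" and N: "N = 2 ^ (Suc (card A) ^ s)"
    and k1: "robustness N s 0 (2 * d + 1) \<le> k1"
    and k0: "robustness N s k1 (2 * d + 1) \<le> k0" "k1 < k0"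
  shows "csp_solvable \<Phi>"
proof -
  define V where "V = vars \<Phi>"
  \<comment> \<open>Budgets left at stage \<open>i\<close>. The last possible stage is
    \<open>2 * d\<close>, and one more extension has to be affordable there. The base
    \<open>k1\<close> lets a test set for \<open>I0\<close> be a whole
    \<open>k1\<close>-set.\<close>
  let ?t0 = "\<lambda>i. robustness N s k1 (2 * d + 1 - i)"
  let ?t1 = "\<lambda>i. robustness N s 0 (2 * d + 1 - i)"
  have I0: "I0 U \<subseteq> Collect (partial_solution \<Phi> U)" "finite (I0 U) \<and> card (I0 U) \<le> d"
    if "U \<in> nsets V k0" for U
    using wit that by (auto simp: value_witness_def V_def)
  have I1: "I1 U \<subseteq> Collect (partial_solution \<Phi> U)" "finite (I1 U) \<and> card (I1 U) \<le> d"
    if "U \<in> nsets V k1" for U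
    using wit that by (auto simp: value_witness_def V_def)
  have I01: "\<exists>f\<in>I0 U. restrict f Z \<in> I1 Z" if "U \<in> nsets V k0" "Z \<in> nsets V k1" "Z \<subseteq> U" for U Z
    using wit that by (auto simp: value_witness_def V_def)
  have al: "alphabet \<Phi> = A"
    using inst by (simp add: csp_instance_def)
  have I0A: "I0 U \<subseteq> U \<rightarrow>\<^sub>E A" if "U \<in> nsets V k0" for U
    using I0(1)[OF that] al unfolding partial_solution_def by blast
  have I1A: "I1 U \<subseteq> U \<rightarrow>\<^sub>E A" if "U \<in> nsets V k1" for U
    using I1(1)[OF that] al unfolding partial_solution_def by blast

  \<comment> \<open>Stage \<open>i\<close> may spend \<open>i * m\<close> variables and must exhibit
    \<open>i\<close> elements of \<open>Q \<union> R\<close>. As both sets have at most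
    \<open>d\<close> elements, there is a last stage.\<close>
  define P where "P = (\<lambda>i S Q R. S \<subseteq> V \<and> finite S \<and> card S \<le> i * m \<and>
      robust V k0 I0 (?t0 i) S Q \<and> robust V k1 I1 (?t1 i) S R \<and> i \<le> card (Q \<union> R))"
  have large0: "infinite V \<or> k0 \<le> card V" and large1: "infinite V \<or> k1 \<le> card V"
    using large k0 by (auto simp: V_def)
  \<comment> \<open>The lists are nonempty by the third condition on the collections: each
    \<open>k0\<close>-set contains a \<open>k1\<close>-set, and by \<open>large0\<close> each
    \<open>k1\<close>-set lies in a \<open>k0\<close>-set.\<close>
  have I0_ne: "I0 U \<noteq> {}" if U: "U \<in> nsets V k0" for U
  proof -
    have "finite U" "card U = k0" "U \<subseteq> V"
      using U by (auto simp: nsets_def)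
    moreover from this obtain Z where "Z \<in> nsets U k1"
      using exists_nsets_superset[of "{}" U k1] k0(2) by auto
    ultimately have "Z \<in> nsets V k1" "Z \<subseteq> U"
      by (auto simp: nsets_def)
    then show ?thesis
      using I01[OF U] by blast
  qed
  have I1_ne: "I1 Z \<noteq> {}" if Z: "Z \<in> nsets V k1" for Z
  proof -
    have "finite Z" "card Z = k1" "Z \<subseteq> V"
      using Z by (auto simp: nsets_def)
    then obtain U where "U \<in> nsets V k0" "Z \<subseteq> U"
      using exists_nsets_superset[of Z V k0] k0(2) large0 by auto
    then show ?thesis
      using I01[OF _ Z] by blast
  qed
  have "P 0 {} {\<lambda>x. undefined} {\<lambda>x. undefined}"
    using robust_empty[OF large0 _ I0_ne] robust_empty[OF large1 _ I1_ne] k0(1) k1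
    by (simp add: P_def)
  moreover have P_le: "i \<le> 2 * d" if "P i S Q R" for i S Q R
  proof -
    have "card Q \<le> d" "card R \<le> d"
      using that finite_robust[OF _ I0(2)] finite_robust[OF _ I1(2)] by (auto simp: P_def)
    then show ?thesis
      using that card_Un_le[of Q R] by (auto simp: P_def)
  qed
  ultimately obtain i where "\<exists>S Q R. P i S Q R" and i_max: "\<And>j. \<exists>S Q R. P j S Q R \<Longrightarrow> j \<le> i"
    using GreatestI_nat[of "\<lambda>i. \<exists>S Q R. P i S Q R" 0 "2 * d"]
      Greatest_le_nat[of "\<lambda>i. \<exists>S Q R. P i S Q R" _ "2 * d"] by (metis (no_types, lifting))
  then obtain S Q R where PS: "P i S Q R" by blast
  then have S: "S \<subseteq> V" "finite S" "card S \<le> i * m" and i_card: "i \<le> card (Q \<union> R)"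
    and rQ: "robust V k0 I0 (?t0 i) S Q" and rR: "robust V k1 I1 (?t1 i) S R"
    by (auto simp: P_def)
  have i_le: "i \<le> 2 * d"
    using P_le[OF PS] .
  define t0 where "t0 = ?t0 (Suc i)"
  define t1 where "t1 = ?t1 (Suc i)"
  have Suc_i: "2 * d + 1 - i = Suc (2 * d + 1 - Suc i)"
    using i_le by simp
  have t0: "?t0 i = N * t0 + s" and t1: "?t1 i = N * t1 + s"
    unfolding t0_def t1_def Suc_i by simp_all

  \<comment> \<open>By maximality of \<open>i\<close>, the set \<open>Q' \<union> R'\<close> is no
    larger than its image \<open>Q \<union> R\<close>, which forces injectivity.\<close>
  have stable: "inj_on (\<lambda>f. restrict f S) (Q' \<union> R')"
    if "S' \<subseteq> V" "finite S'" "card S' \<le> card S + m"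
      and Q': "robust V k0 I0 t0 S' Q'" "(\<lambda>f. restrict f S) ` Q' = Q"
      and R': "robust V k1 I1 t1 S' R'" "(\<lambda>f. restrict f S) ` R' = R" for S' Q' R'
  proof -
    have "\<not> P (Suc i) S' Q' R'"
      using i_max[of "Suc i"] by auto
    then have "card (Q' \<union> R') \<le> card (Q \<union> R)"
      using that S i_card unfolding P_def t0_def t1_def by auto
    moreover have fin: "finite (Q' \<union> R')"
      using finite_robust[OF Q'(1) I0(2)] finite_robust[OF R'(1) I1(2)] by simp
    moreover have img: "(\<lambda>f. restrict f S) ` (Q' \<union> R') = Q \<union> R"
      using Q' R' by (simp add: image_Un)
    ultimately show ?thesis
      using card_image_le[OF fin, of "\<lambda>f. restrict f S"] by (intro eq_card_imp_inj_on) auto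
  qed

  have k1_le: "k1 \<le> robustness N s k1 j" for j
  proof (induction j)
    case (Suc j)
    have "1 \<le> N"
      unfolding N by simp
    then have "robustness N s k1 j \<le> N * robustness N s k1 j"
      by simp
    with Suc show ?case
      unfolding robustness.simps by (meson order.trans trans_le_add1)
  qed simp
  \<comment> \<open>Realise \<open>R\<close> on a \<open>k1\<close>-set \<open>Z\<close> and use
    \<open>Z\<close> itself as the test set for \<open>Q\<close>. The third condition applied to the
    resulting pair gives a common element.\<close>
  obtain h0 where h0: "h0 \<in> Q" "h0 \<in> R"
  proof -
    obtain Z where Z: "Z \<in> nsets V k1" "S \<subseteq> Z" "(\<lambda>f. restrict f S) ` I1 Z = R"
      using robust_witness[OF rR] .
    then have "Z \<subseteq> V" "finite Z" "card Z \<le> ?t0 i"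
      using k1_le by (simp_all add: nsets_def)
    with rQ obtain U where U: "U \<in> nsets V k0" "Z \<subseteq> U" "(\<lambda>f. restrict f S) ` I0 U = Q"
      by (rule robustD)
    obtain f where f: "f \<in> I0 U" "restrict f Z \<in> I1 Z"
      using I01[OF U(1) Z(1) U(2)] by blast
    have "restrict (restrict f Z) S = restrict f S"
      using Z(2) by (simp add: Int_absorb1)
    then have "restrict f S \<in> R"
      using f(2) Z(3) by (metis imageI)
    with f(1) U(3) that show ?thesis by blast
  qed

  have bnd: "finite (Pow (S' \<rightarrow>\<^sub>E A)) \<and> card (Pow (S' \<rightarrow>\<^sub>E A)) \<le> N \<and> card S' \<le> s"
    if "finite S'" "card S' \<le> card S + m" for S' :: "'v set"
  proof -
    have "card S' \<le> Suc i * m"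
      using that S by simp
    also have "\<dots> \<le> s"
      unfolding s using i_le by (intro mult_le_mono1) simp
    finally show ?thesis
      using card_Pow_PiE_le[OF that(1) _ A] N by blast
  qed
  have extQ: "\<exists>Q'. robust V k0 I0 t0 S' Q' \<and> (\<lambda>f. restrict f S) ` Q' = Q"
    if "S \<subseteq> S'" "S' \<subseteq> V" "finite S'" "card S' \<le> card S + m" for S'
    using robust_extend[OF rQ[unfolded t0] I0A that(1-3)] bnd[OF that(3,4)] by blast
  have extR: "\<exists>R'. robust V k1 I1 t1 S' R' \<and> (\<lambda>f. restrict f S) ` R' = R"
    if "S \<subseteq> S'" "S' \<subseteq> V" "finite S'" "card S' \<le> card S + m" for S'
    using robust_extend[OF rR[unfolded t1] I1A that(1-3)] bnd[OF that(3,4)] by blast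

  define H where "H = (\<lambda>S' h. \<exists>Q'. robust V k0 I0 t0 S' Q' \<and>
      (\<lambda>f. restrict f S) ` Q' = Q \<and> h \<in> Q' \<and> restrict h S = h0)"
  show ?thesis
  proof (rule csp_solvable_if_compatible_extensions[OF inst \<open>m > 0\<close>, of S H])
    show "S \<subseteq> vars \<Phi>" "finite S"
      using S by (auto simp: V_def)
  next
    fix S' assume "S \<subseteq> S'" "S' \<subseteq> vars \<Phi>" "finite S'" "card S' \<le> card S + m"
    then obtain Q' where "robust V k0 I0 t0 S' Q'" "(\<lambda>f. restrict f S) ` Q' = Q"
      using extQ V_def by blast
    then show "\<exists>h. H S' h"
      using h0(1) unfolding H_def by blast
  next
    fix S' h h'
    assume S': "S \<subseteq> S'" "S' \<subseteq> vars \<Phi>" "finite S'" "card S' \<le> card S + m" and H: "H S' h" "H S' h'"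
    have S'V: "S' \<subseteq> V"
      using S' V_def by simp
    obtain R' where R': "robust V k1 I1 t1 S' R'" "(\<lambda>f. restrict f S) ` R' = R"
      using extR[OF S'(1) S'V S'(3,4)] by blast
    then obtain r where r: "r \<in> R'" "restrict r S = h0"
      using h0(2) by blast
    \<comment> \<open>The functions \<open>h\<close> and \<open>h'\<close> may come from different
      sets \<open>Q'\<close>, so they are not compared directly: each equals \<open>r\<close>, which
      comes from the fixed \<open>R'\<close>.\<close>
    have eq_r: "g = r" if Hg: "H S' g" for g
    proof -
      obtain Q' where "robust V k0 I0 t0 S' Q'" "(\<lambda>f. restrict f S) ` Q' = Q" "g \<in> Q'" "restrict g S = h0"
        using Hg unfolding H_def by blast
      with stable[OF S'V S'(3,4) _ _ R'] r show ?thesis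
        by (auto dest: inj_onD)
    qed
    show "h = h'"
      using eq_r[OF H(1)] eq_r[OF H(2)] by simp
  next
    fix S' S'' h assume S': "S \<subseteq> S'" "S' \<subseteq> S''" and "H S'' h"
    then obtain Q' where Q': "robust V k0 I0 t0 S'' Q'" "(\<lambda>f. restrict f S) ` Q' = Q" "h \<in> Q'" "restrict h S = h0"
      unfolding H_def by blast
    have "restrict (restrict g S') S = restrict g S" for g :: "'v \<Rightarrow> 'a"
      using S'(1) by (simp add: Int_absorb1)
    then show "H S' (restrict h S')"
      unfolding H_def using Q' robust_restrict[OF Q'(1) S'(2)]
      by (intro exI[of _ "(\<lambda>f. restrict f S') ` Q'"]) (simp add: image_image)
  next
    fix S' h assume "H S' h"
    then obtain Q' where Q': "robust V k0 I0 t0 S' Q'" "h \<in> Q'"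
      unfolding H_def by blast
    obtain U where U: "U \<in> nsets V k0" "S' \<subseteq> U" "(\<lambda>f. restrict f S') ` I0 U = Q'"
      using robust_witness[OF Q'(1)] .
    then obtain g where "g \<in> I0 U" "h = restrict g S'"
      using Q'(2) by blast
    then show "partial_solution \<Phi> S' h"
      using I0(1)[OF U(1)] U(2) partial_solution_restrict by blast
  qed
qed

subsection \<open>The gap\<close>

lemma value_witness_mono:
  assumes "value_witness k0 k1 \<Phi> d I0 I1" "d \<le> d'"
  shows "value_witness k0 k1 \<Phi> d' I0 I1"
proof -
  have "n \<le> d \<Longrightarrow> n \<le> d'" for n
    using assms(2) by simp
  with assms(1) show ?thesis
    unfolding value_witness_def by simp
qed

text \<open>A finite bound excludes the empty set, whose infimum is infinite; infima of nonempty
  sets are attained in a well-order.\<close>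

lemma Inf_enat_in:
  fixes X :: "enat set"
  assumes "Inf X \<le> enat d"
  shows "Inf X \<in> X"
proof -
  have "X \<noteq> {}"
    using assms by (auto simp: Inf_enat_def)
  then show ?thesis
    using wellorder_InfI by blast
qed

lemma csp_val_le_imp_witness:
  assumes "csp_val k0 k1 \<Phi> \<le> enat d"
  obtains I0 I1 where "value_witness k0 k1 \<Phi> d I0 I1"
proof -
  let ?X = "{enat d | d. d > 0 \<and> (\<exists>I0 I1. value_witness k0 k1 \<Phi> d I0 I1)}"
  have "Inf ?X \<le> enat d"
    using assms by (simp only: csp_val_def)
  then have "Inf ?X \<in> ?X"
    by (rule Inf_enat_in)
  then obtain d' I0 I1 where "Inf ?X = enat d'" "value_witness k0 k1 \<Phi> d' I0 I1"
    by blast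
  with \<open>Inf ?X \<le> enat d\<close> value_witness_mono show ?thesis
    by (intro that) simp
qed

lemma csp_val_eq_1:
  assumes "value_witness k0 k1 \<Phi> 1 I0 I1"
  shows "csp_val k0 k1 \<Phi> = 1"
proof (rule antisym)
  show "csp_val k0 k1 \<Phi> \<le> 1"
    unfolding csp_val_def using assms by (intro Inf_lower) (auto simp: one_enat_def)
  show "1 \<le> csp_val k0 k1 \<Phi>"
    unfolding csp_val_def by (intro Inf_greatest) (auto simp: one_enat_def)
qed

text \<open>The restrictions of one solution serve as singleton lists.\<close>

lemma csp_val_solvable:
  assumes "csp_solvable \<Phi>"
  shows "csp_val k0 k1 \<Phi> = 1"
proof -
  obtain f where f: "csp_solution \<Phi> f"
    using assms csp_solvable_def by blast
  have "partial_solution \<Phi> (vars \<Phi>) f"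
    using f by (auto simp: csp_solution_def partial_solution_def)
  then have "partial_solution \<Phi> U (restrict f U)" if "U \<subseteq> vars \<Phi>" for U
    using that partial_solution_restrict by blast
  then have "value_witness k0 k1 \<Phi> 1 (\<lambda>U. {restrict f U}) (\<lambda>U. {restrict f U})"
    by (auto simp: value_witness_def nsets_def Int_absorb1)
  then show ?thesis
    by (rule csp_val_eq_1)
qed

text \<open>Without \<open>k0\<close>-sets the third condition is vacuous and empty lists suffice,
  so here value 1 does not imply solvability.\<close>

lemma csp_val_few_vars:
  assumes "finite (vars \<Phi>)" "card (vars \<Phi>) < k0"
  shows "csp_val k0 k1 \<Phi> = 1"
proof (rule csp_val_eq_1)
  have "nsets (vars \<Phi>) k0 = {}"
    using assms by (simp add: nsets_eq_empty_iff)
  then show "value_witness k0 k1 \<Phi> 1 (\<lambda>U. {}) (\<lambda>U. {})"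
    by (simp add: value_witness_def)
qed

theorem theorem1:
  fixes A :: "'a set" and m d :: nat
  assumes "finite A" and "m > 0" and "d > 0"
  shows "\<exists>k0 k1 :: nat. k0 \<ge> m \<and> k1 \<ge> m \<and> k0 > k1 \<and>
    (\<forall>\<Phi> :: ('v, 'a) csp. csp_instance m A \<Phi> \<longrightarrow>
       (csp_val k0 k1 \<Phi> = 1 \<or> csp_val k0 k1 \<Phi> > enat d) \<and>
       (csp_solvable \<Phi> \<longrightarrow> csp_val k0 k1 \<Phi> = 1) \<and>
       (csp_val k0 k1 \<Phi> = 1 \<and> (infinite (vars \<Phi>) \<or> card (vars \<Phi>) \<ge> k0) \<longrightarrow> csp_solvable \<Phi>))"
proof -
  define s where "s = (2 * d + 1) * m"
  define N :: nat where "N = 2 ^ (Suc (card A) ^ s)"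
  \<comment> \<open>\<open>k1\<close> comes first because it is the base of the budget in
    \<open>k0\<close>. The summands \<open>m\<close> and \<open>Suc k1\<close> ensure
    \<open>m \<le> k1 < k0\<close>.\<close>
  define k1 where "k1 = robustness N s 0 (2 * d + 1) + m"
  define k0 where "k0 = robustness N s k1 (2 * d + 1) + Suc k1"
  have k: "robustness N s 0 (2 * d + 1) \<le> k1" "robustness N s k1 (2 * d + 1) \<le> k0" "k1 < k0" "m \<le> k1"
    by (simp_all add: k0_def k1_def)
  have solvable: "csp_solvable \<Phi>"
    if "csp_instance m A \<Phi>" "csp_val k0 k1 \<Phi> \<le> enat d" "infinite (vars \<Phi>) \<or> k0 \<le> card (vars \<Phi>)"
    for \<Phi> :: "('v, 'a) csp"
    using csp_val_le_imp_witness[OF that(2)]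
      value_witness_imp_solvable[OF assms(1,2) that(1) _ that(3) s_def N_def k(1-3)] by blast
  have gap: "csp_val k0 k1 \<Phi> = 1 \<or> csp_val k0 k1 \<Phi> > enat d" if "csp_instance m A \<Phi>" for \<Phi> :: "('v, 'a) csp"
    using solvable[OF that] csp_val_solvable csp_val_few_vars not_le by metis
  have conv: "csp_solvable \<Phi>"
    if "csp_instance m A \<Phi>" "csp_val k0 k1 \<Phi> = 1" "infinite (vars \<Phi>) \<or> k0 \<le> card (vars \<Phi>)"
    for \<Phi> :: "('v, 'a) csp"
    \<comment> \<open>Value 1 is at most \<open>d\<close> because \<open>d > 0\<close>.\<close>
    using solvable[OF that(1) _ that(3)] that(2) assms(3) by (simp add: one_enat_def)
  have "m \<le> k0"
    using k(3,4) by simp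
  show ?thesis
  proof (intro exI conjI allI impI)
    show "m \<le> k0" "m \<le> k1" "k1 < k0"
      by fact+
  qed (use gap conv csp_val_solvable in simp_all)
qed

end
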